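(* The atom $x\in y$ is not existentially expressible in $\mathbb{BST}^{+}$: there is no $\mathbb{BST}^{+}$-formula $\Psi(x,y,\vec z)$ (with $\vec z$ a tuple of set variables distinct from $x,y$) such that \[ \models\; x\in y \;\longleftrightarrow\; (\exists \vec z)\,\Psi(x,y,\vec z). \]
   Context: $\mathbb{BST}^{+}$ is the collection of all propositional combinations (using $\wedge,\vee,\to,\leftrightarrow,\neg$) of atoms of the form $x' = y'\setminus z'$, where the variables are set variables ranging over the von Neumann universe $\mathcal{V}$ of well-founded sets and $\setminus$ is ordinary set difference. $\models$ denotes truth under every assignment of sets in $\mathcal{V}$ to the free variables. A formula $\psi(\vec x)$ is existentially expressible in a theory $\mathcal{T}$ if there is a $\mathcal{T}$-formula $\Psi(\vec x,\vec z)$ with $\models \psi(\vec x)\leftrightarrow(\exists\vec z)\Psi(\vec x,\vec z)$. *)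

theory Defs
  imports Main "HOL-Library.Nat_Bijection"
begin

text \<open>
  HOL has no type of all well-founded sets, so the universe is a parameter: a type \<^typ>\<open>'v\<close>
  with a map \<open>elts\<close> sending each set to the collection of its members, subject to the axioms of
  ZF. Separation and replacement are the full second-order versions, and choice is inherited from
  the metalogic. The axiom of infinity is not imposed: the von Neumann universe is an instance
  either way, and without infinity the axioms have a model definable in HOL (see below).
  Pairing and the empty set follow from the other axioms.
\<close>

locale set_universe =
  fixes elts :: "'v \<Rightarrow> 'v set"
  assumes extensionality: "elts u = elts v \<Longrightarrow> u = v"
    and foundation: "wf {(u, v). u \<in> elts v}"
    and separation: "Y \<subseteq> elts u \<Longrightarrow> \<exists>v. elts v = Y"
    and union: "\<exists>v. elts v = (\<Union>w\<in>elts u. elts w)"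
    and powerset: "\<exists>v. elts v = {w. elts w \<subseteq> elts u}"
    and replacement: "\<exists>v. elts v = f ` elts u"

text \<open>The hereditarily finite sets, in Ackermann's coding, satisfy the axioms.\<close>

lemma set_universe_set_decode: "set_universe set_decode"
proof
  have fin: "\<exists>v. set_decode v = Y" if "finite Y" for Y
    using that set_encode_inverse by blast
  show "u = v" if "set_decode u = set_decode v" for u v
    using that by (metis set_decode_inverse)
  have lt: "u < v" if "u \<in> set_decode v" for u v
  proof -
    have "2 ^ u \<le> v"
      using that by (metis div_less even_zero not_le set_decode_def mem_Collect_eq)
    then show ?thesis
      using less_exp[of u] by linarith
  qed
  show "wf {(u, v). u \<in> set_decode v}"
    by (rule wf_subset[OF wf_less_than]) (auto simp: lt)
  show "\<exists>v. set_decode v = Y" if "Y \<subseteq> set_decode u" for Y u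
    using that by (intro fin) (metis finite_set_decode finite_subset)
  show "\<exists>v. set_decode v = (\<Union>w\<in>set_decode u. set_decode w)" for u
    by (intro fin) simp
  show "\<exists>v. set_decode v = {w. set_decode w \<subseteq> set_decode u}" for u
  proof (rule fin)
    have "{w. set_decode w \<subseteq> set_decode u} \<subseteq> set_encode ` Pow (set_decode u)"
      by (metis (no_types, lifting) PowI image_eqI mem_Collect_eq set_decode_inverse subsetI)
    then show "finite {w. set_decode w \<subseteq> set_decode u}"
      by (rule finite_subset) simp
  qed
  show "\<exists>v. set_decode v = f ` set_decode u" for f u
    by (intro fin) simp
qed

definition set_diff :: "('v \<Rightarrow> 'v set) \<Rightarrow> 'v \<Rightarrow> 'v \<Rightarrow> 'v" where
  "set_diff elts u v = (THE w. elts w = elts u - elts v)"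

lemma (in set_universe) elts_set_diff: "elts (set_diff elts u v) = elts u - elts v"
  unfolding set_diff_def
  by (rule theI') (metis Diff_subset extensionality separation)

type_synonym var = nat

datatype fm =
    Mem var var
  | Eq_Diff var var var
  | Neg fm
  | Conj fm fm
  | Disj fm fm
  | Imp fm fm
  | Iff fm fm
  | Exists var fm

primrec sat :: "('v \<Rightarrow> 'v set) \<Rightarrow> (var \<Rightarrow> 'v) \<Rightarrow> fm \<Rightarrow> bool" where
  "sat elts M (Mem x y) \<longleftrightarrow> M x \<in> elts (M y)"
| "sat elts M (Eq_Diff x y z) \<longleftrightarrow> M x = set_diff elts (M y) (M z)"
| "sat elts M (Neg \<phi>) \<longleftrightarrow> \<not> sat elts M \<phi>"
| "sat elts M (Conj \<phi> \<psi>) \<longleftrightarrow> sat elts M \<phi> \<and> sat elts M \<psi>"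
| "sat elts M (Disj \<phi> \<psi>) \<longleftrightarrow> sat elts M \<phi> \<or> sat elts M \<psi>"
| "sat elts M (Imp \<phi> \<psi>) \<longleftrightarrow> (sat elts M \<phi> \<longrightarrow> sat elts M \<psi>)"
| "sat elts M (Iff \<phi> \<psi>) \<longleftrightarrow> (sat elts M \<phi> \<longleftrightarrow> sat elts M \<psi>)"
| "sat elts M (Exists x \<phi>) \<longleftrightarrow> (\<exists>u. sat elts (M(x := u)) \<phi>)"

definition valid :: "('v \<Rightarrow> 'v set) \<Rightarrow> fm \<Rightarrow> bool" where
  "valid elts \<phi> \<longleftrightarrow> (\<forall>M. sat elts M \<phi>)"

primrec free_vars :: "fm \<Rightarrow> var set" where
  "free_vars (Mem x y) = {x, y}"
| "free_vars (Eq_Diff x y z) = {x, y, z}"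
| "free_vars (Neg \<phi>) = free_vars \<phi>"
| "free_vars (Conj \<phi> \<psi>) = free_vars \<phi> \<union> free_vars \<psi>"
| "free_vars (Disj \<phi> \<psi>) = free_vars \<phi> \<union> free_vars \<psi>"
| "free_vars (Imp \<phi> \<psi>) = free_vars \<phi> \<union> free_vars \<psi>"
| "free_vars (Iff \<phi> \<psi>) = free_vars \<phi> \<union> free_vars \<psi>"
| "free_vars (Exists x \<phi>) = free_vars \<phi> - {x}"

inductive_set BST_plus :: "fm set" where
  "Eq_Diff x y z \<in> BST_plus"
| "\<phi> \<in> BST_plus \<Longrightarrow> Neg \<phi> \<in> BST_plus"
| "\<phi> \<in> BST_plus \<Longrightarrow> \<psi> \<in> BST_plus \<Longrightarrow> Conj \<phi> \<psi> \<in> BST_plus"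
| "\<phi> \<in> BST_plus \<Longrightarrow> \<psi> \<in> BST_plus \<Longrightarrow> Disj \<phi> \<psi> \<in> BST_plus"
| "\<phi> \<in> BST_plus \<Longrightarrow> \<psi> \<in> BST_plus \<Longrightarrow> Imp \<phi> \<psi> \<in> BST_plus"
| "\<phi> \<in> BST_plus \<Longrightarrow> \<psi> \<in> BST_plus \<Longrightarrow> Iff \<phi> \<psi> \<in> BST_plus"

definition existentially_expressible :: "('v \<Rightarrow> 'v set) \<Rightarrow> fm set \<Rightarrow> fm \<Rightarrow> bool" where
  "existentially_expressible elts T \<psi> \<longleftrightarrow>
    (\<exists>\<Psi>\<in>T. \<exists>zs. distinct zs \<and> set zs \<inter> free_vars \<psi> = {} \<and>
      free_vars \<Psi> \<subseteq> free_vars \<psi> \<union> set zs \<and>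
      valid elts (Iff \<psi> (foldr Exists zs \<Psi>)))"

end

theory Submission imports Defs "HOL-Combinatorics.Transposition" begin

text \<open>
  Formulas of \<^const>\<open>BST_plus\<close> cannot distinguish an assignment \<open>M\<close> from the assignment that
  sends each variable \<open>v\<close> to the image of \<open>M v\<close> under a fixed injection \<open>f\<close> of the universe,
  because taking images under \<open>f\<close> is injective and commutes with set difference.
  The transposition of \<open>\<emptyset>\<close> and \<open>{\<emptyset>}\<close> turns \<open>x = \<emptyset>\<close>, \<open>y = {\<emptyset>}\<close> into
  \<open>x = \<emptyset>\<close>, \<open>y = {{\<emptyset>}}\<close>, so it destroys \<open>x \<in> y\<close>.
\<close>

lemma sat_foldr_Exists_imp:
  "sat elts M (foldr Exists zs \<phi>) \<Longrightarrow> \<exists>N. (\<forall>v. v \<notin> set zs \<longrightarrow> N v = M v) \<and> sat elts N \<phi>"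
proof (induction zs arbitrary: M)
  case Nil
  then show ?case by auto
next
  case (Cons z zs)
  then obtain u where "sat elts (M(z := u)) (foldr Exists zs \<phi>)"
    by auto
  from Cons.IH[OF this] show ?case
    by (metis fun_upd_other list.set_intros(1,2))
qed

text \<open>The values that \<open>M\<close> already gives to \<open>zs\<close> are the
  witnesses.\<close>

lemma sat_imp_foldr_Exists: "sat elts M \<phi> \<Longrightarrow> sat elts M (foldr Exists zs \<phi>)"
proof (induction zs)
  case (Cons z zs)
  then show ?case
    by simp (metis fun_upd_triv)
qed simp

lemma (in set_universe) sat_BST_plus_image_iff:
  assumes "\<phi> \<in> BST_plus" and f: "inj f" and F: "\<And>u. elts (F u) = f ` elts u"
  shows "sat elts (F \<circ> M) \<phi> \<longleftrightarrow> sat elts M \<phi>"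
proof -
  have eq_diff: "u = set_diff elts v w \<longleftrightarrow> elts u = elts v - elts w" for u v w
    using extensionality elts_set_diff by metis
  have image_diff: "f ` A = f ` B - f ` C \<longleftrightarrow> A = B - C" for A B C
    using f by (metis image_set_diff inj_image_eq_iff)
  show ?thesis
    using assms(1) by (induction rule: BST_plus.induct) (simp_all add: eq_diff F image_diff)
qed

theorem theorem1:
  fixes elts :: "'v \<Rightarrow> 'v set" and x y :: var
  assumes "set_universe elts" and "x \<noteq> y"
  shows "\<not> existentially_expressible elts BST_plus (Mem x y)"
proof
  interpret set_universe elts by fact
  assume "existentially_expressible elts BST_plus (Mem x y)"
  then obtain \<Psi> zs where \<Psi>: "\<Psi> \<in> BST_plus" and zs: "x \<notin> set zs" "y \<notin> set zs"
    and equiv: "\<And>M. M x \<in> elts (M y) \<longleftrightarrow> sat elts M (foldr Exists zs \<Psi>)"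
    unfolding existentially_expressible_def valid_def by auto
  obtain e where e: "elts e = {}"
    using separation[of "{}"] by auto
  obtain s where s: "elts s = {e}"
  proof -
    \<comment> \<open>The singleton of \<open>e\<close> arises as the power set of the empty
      set.\<close>
    have "{w. elts w \<subseteq> elts e} = {e}"
      using e extensionality by auto
    then show ?thesis
      using powerset[of e] that by auto
  qed
  define f where "f = transpose e s"
  obtain F where F: "\<And>u. elts (F u) = f ` elts u"
    using replacement by metis
  have "e \<noteq> s"
    using e s by auto
  \<comment> \<open>Only the values at \<open>x\<close> and \<open>y\<close> matter;
    \<open>e\<close> elsewhere is a default.\<close>
  have "sat elts ((\<lambda>_. e)(y := s)) (foldr Exists zs \<Psi>)"
    using equiv[of "(\<lambda>_. e)(y := s)"] s \<open>x \<noteq> y\<close> by simp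
  from sat_foldr_Exists_imp[OF this]
  obtain N where N: "N x = e" "N y = s" "sat elts N \<Psi>"
    using zs \<open>x \<noteq> y\<close> by (metis fun_upd_apply)
  have "inj f"
    by (simp add: f_def)
  \<comment> \<open>The images under \<open>F\<close> of the old witnesses are the new ones.\<close>
  then have "sat elts (F \<circ> N) (foldr Exists zs \<Psi>)"
    using sat_BST_plus_image_iff[OF \<Psi>] F N(3) by (blast intro: sat_imp_foldr_Exists)
  then have "F e \<in> elts (F s)"
    using equiv[of "F \<circ> N"] N by simp
  moreover have "F e = e"
    using F e extensionality by simp
  \<comment> \<open>The only element of \<open>F s\<close> is \<open>f e\<close>, which is
    \<open>s\<close>, so membership would force \<open>e = s\<close>.\<close>
  ultimately show False
    using \<open>e \<noteq> s\<close> by (simp add: F s f_def)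
qed

end
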